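(* Let $a$, $b$ and $n>1$ be positive integers, let $i\in\{1,\ldots,n\}$, and let $I_2(X)$ be the ideal of $\Bbbk[x_1,\ldots,x_n]$ generated by the $2\times 2$-minors of $$X := \left(\begin{array}{cccc} x_1^b & \ldots & x_{n-1}^b & x_n^b \\ x_2 & \ldots & x_n & x_1^{a+1} \end{array}\right).$$ Let $\mathcal{G} = \mathcal{G}^{(i)}_1 \cup \mathcal{G}^{(i)}_2 \cup \mathcal{G}^{(i)}_3 \cup \mathcal{G}^{(i)}_4$, where $$\mathcal{G}^{(i)}_1 = \left\{ x_{j+1} x_k^b - x_j^b x_{k+1} \ \mid\ j \in \{i, \ldots, n-2\},\ k \in \{j+1,\ldots, n-1\}\right\},$$ $$\mathcal{G}^{(i)}_2 = \left\{ x_{j+1} x_k^b - x_j^b x_{k+1} \ \mid\ j \in \{1, \ldots, i-2\},\ k \in \{j+1,\ldots, i-1\}\right\},$$ $$\mathcal{G}^{(i)}_3 = \left\{ x_j^b x_{k+1} - x_{j+1} x_k^b \ \mid\ j \in \{1, \ldots, i-1\},\ k \in \{i,\ldots, n-1\}\right\},$$ $$\mathcal{G}^{(i)}_4 = \left\{x_1^{a+1} x_l^b - x_{l+1} x_n^b \ \mid\ l = 1, \ldots, i-1 \right\}\cup \left\{x_{l+1} x_n^b - x_1^{a+1} x_l^b \ \mid\ l = i, \ldots, n-1 \right\}.$$ Then $\mathcal{G}$ is a minimal Gröbner basis of $I_2(X)$ with respect to the term order $\prec_i$ described in the context. In particular, the cardinality of $\mathcal{G}$ is $\binom{n}{2}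$.
   Context: $\Bbbk$ is a field. For a positive integer $b$ and $\ell\ge 1$, $r_b(\ell) := \sum_{j=0}^{\ell-1} b^j$, and $r_b(0):=0$. Set $a_i := r_b(n) + a\, r_b(i-1)$ for $i=1,\ldots,n$, and $\mathcal{A}=\{a_1,\ldots,a_n\}$. The term order $\prec_i$ is the $\mathcal{A}$-graded reverse lexicographical term order on $\Bbbk[x_1,\ldots,x_n]$ induced by $x_i \prec_i x_{i-1} \prec_i \cdots \prec_i x_1 \prec_i x_n \prec_i x_{n-1}\prec_i \cdots \prec_i x_{i+1}$. Explicitly, for distinct monomials $\mathbf{x}^{\mathbf{u}}$ and $\mathbf{x}^{\mathbf{v}}$, one has $\mathbf{x}^{\mathbf{u}} \prec_i \mathbf{x}^{\mathbf{v}}$ if and only if either $\sum_j a_j u_j < \sum_j a_j v_j$, or $\sum_j a_j u_j = \sum_j a_j v_j$ and, for the first index $m$ in the list $i, i-1, \ldots, 1, n, n-1, \ldots, i+1$ with $u_m \ne v_m$, one has $u_m > v_m$. A Gröbner basis is minimal if its elements have leading coefficient $1$ and the leading term of no element is divisible by the leading term of another element. Index sets are empty when the lower bound exceeds the upper bound. *)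

theory Defs
  imports
    "HOL-Library.Poly_Mapping"
    "HOL-Algebra.Ideal"
    "HOL-Algebra.Divisibility"
begin

(* A monomial is its exponent vector, a polynomial is a finitely supported map from
   monomials to coefficients; the product on 'k mpoly is the convolution product.
   The variables are indexed by all naturals; the ring in x_1, ..., x_n is the
   subring mpoly_ring n. *)

type_synonym monom = "nat \<Rightarrow>\<^sub>0 nat"
type_synonym 'k mpoly = "monom \<Rightarrow>\<^sub>0 'k"

definition monoms :: "nat \<Rightarrow> monom set"
  where "monoms n = {u. Poly_Mapping.keys u \<subseteq> {1..n}}"

definition mpoly_ring :: "nat \<Rightarrow> ('k::field) mpoly ring"
  where "mpoly_ring n =
    \<lparr>carrier = {p. Poly_Mapping.keys p \<subseteq> monoms n}, monoid.mult = (*), one = 1, zero = 0, add = (+)\<rparr>"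

definition var :: "nat \<Rightarrow> ('k::field) mpoly"
  where "var j = Poly_Mapping.single (Poly_Mapping.single j 1) 1"

lemma monoms_zero: "0 \<in> monoms n"
  by (simp add: monoms_def)

lemma monoms_add: "u \<in> monoms n \<Longrightarrow> v \<in> monoms n \<Longrightarrow> u + v \<in> monoms n"
  unfolding monoms_def using Poly_Mapping.keys_add[of u v] by blast

lemma mpoly_ring_cring: "cring (mpoly_ring n :: ('k::field) mpoly ring)"
proof -
  have add: "Poly_Mapping.keys (p + q) \<subseteq> monoms n"
    if "Poly_Mapping.keys p \<subseteq> monoms n" "Poly_Mapping.keys q \<subseteq> monoms n" for p q :: "'k mpoly"
    using that Poly_Mapping.keys_add[of p q] by blast
  have mult: "Poly_Mapping.keys (p * q) \<subseteq> monoms n"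
    if "Poly_Mapping.keys p \<subseteq> monoms n" "Poly_Mapping.keys q \<subseteq> monoms n" for p q :: "'k mpoly"
    using that Poly_Mapping.keys_mult[of p q] monoms_add by blast
  show ?thesis
  proof (rule cringI)
    show "abelian_group (mpoly_ring n :: 'k mpoly ring)"
    proof (rule abelian_groupI)
      fix x assume "x \<in> carrier (mpoly_ring n :: 'k mpoly ring)"
      then have "- x \<in> carrier (mpoly_ring n)"
        by (simp add: mpoly_ring_def)
      then show "\<exists>y\<in>carrier (mpoly_ring n). y \<oplus>\<^bsub>mpoly_ring n\<^esub> x = \<zero>\<^bsub>mpoly_ring n\<^esub>"
        by (rule rev_bexI) (simp add: mpoly_ring_def)
    qed (use add in \<open>auto simp: mpoly_ring_def algebra_simps\<close>)
    show "Group.comm_monoid (mpoly_ring n :: 'k mpoly ring)"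
      by (rule comm_monoidI) (use mult monoms_zero in \<open>auto simp: mpoly_ring_def algebra_simps\<close>)
  qed (auto simp: mpoly_ring_def algebra_simps)
qed


definition term_order :: "nat \<Rightarrow> (monom \<Rightarrow> monom \<Rightarrow> bool) \<Rightarrow> bool"
  where "term_order n lt \<longleftrightarrow>
    (\<forall>u\<in>monoms n. \<not> lt u u) \<and>
    (\<forall>u\<in>monoms n. \<forall>v\<in>monoms n. \<forall>w\<in>monoms n. lt u v \<longrightarrow> lt v w \<longrightarrow> lt u w) \<and>
    (\<forall>u\<in>monoms n. \<forall>v\<in>monoms n. u \<noteq> v \<longrightarrow> lt u v \<or> lt v u) \<and>
    (\<forall>u\<in>monoms n. u \<noteq> 0 \<longrightarrow> lt 0 u) \<and>
    (\<forall>u\<in>monoms n. \<forall>v\<in>monoms n. \<forall>w\<in>monoms n. lt u v \<longrightarrow> lt (u + w) (v + w))"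

(* The next three notions are meaningful only for nonzero polynomials and for relations
   that are total on the monomials occurring in them. *)

definition lead_monom :: "(monom \<Rightarrow> monom \<Rightarrow> bool) \<Rightarrow> ('k::field) mpoly \<Rightarrow> monom"
  where "lead_monom lt p =
    (THE u. u \<in> Poly_Mapping.keys p \<and> (\<forall>v\<in>Poly_Mapping.keys p. v \<noteq> u \<longrightarrow> lt v u))"

definition lead_coef :: "(monom \<Rightarrow> monom \<Rightarrow> bool) \<Rightarrow> ('k::field) mpoly \<Rightarrow> 'k"
  where "lead_coef lt p = Poly_Mapping.lookup p (lead_monom lt p)"

definition lead_term :: "(monom \<Rightarrow> monom \<Rightarrow> bool) \<Rightarrow> ('k::field) mpoly \<Rightarrow> 'k mpoly"
  where "lead_term lt p = Poly_Mapping.single (lead_monom lt p) (lead_coef lt p)"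

definition initial_ideal ::
  "nat \<Rightarrow> (monom \<Rightarrow> monom \<Rightarrow> bool) \<Rightarrow> ('k::field) mpoly set \<Rightarrow> 'k mpoly set"
  where "initial_ideal n lt S = Idl\<^bsub>mpoly_ring n\<^esub> (lead_term lt ` (S - {0}))"

definition groebner_basis ::
  "nat \<Rightarrow> (monom \<Rightarrow> monom \<Rightarrow> bool) \<Rightarrow> ('k::field) mpoly set \<Rightarrow> 'k mpoly set \<Rightarrow> bool"
  where "groebner_basis n lt I G \<longleftrightarrow>
    finite G \<and> G \<subseteq> I \<and> initial_ideal n lt G = initial_ideal n lt I"

definition minimal_groebner_basis ::
  "nat \<Rightarrow> (monom \<Rightarrow> monom \<Rightarrow> bool) \<Rightarrow> ('k::field) mpoly set \<Rightarrow> 'k mpoly set \<Rightarrow> bool"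
  where "minimal_groebner_basis n lt I G \<longleftrightarrow>
    groebner_basis n lt I G \<and>
    (\<forall>g\<in>G. lead_coef lt g = 1) \<and>
    (\<forall>g\<in>G. \<forall>h\<in>G. g \<noteq> h \<longrightarrow> \<not> lead_term lt g divides\<^bsub>mpoly_ring n\<^esub> lead_term lt h)"


definition repunit :: "nat \<Rightarrow> nat \<Rightarrow> nat"
  where "repunit b l = (\<Sum>j<l. b ^ j)"

definition weight :: "nat \<Rightarrow> nat \<Rightarrow> nat \<Rightarrow> nat \<Rightarrow> nat"
  where "weight a b n j = repunit b n + a * repunit b (j - 1)"

definition wdeg :: "nat \<Rightarrow> nat \<Rightarrow> nat \<Rightarrow> monom \<Rightarrow> nat"
  where "wdeg a b n u = (\<Sum>j=1..n. weight a b n j * Poly_Mapping.lookup u j)"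

(* The variables in increasing order: i, i-1, ..., 1, n, n-1, ..., i+1. *)

definition var_list :: "nat \<Rightarrow> nat \<Rightarrow> nat list"
  where "var_list n i = rev [1..<i + 1] @ rev [i + 1..<n + 1]"

definition first_diff_greater :: "nat list \<Rightarrow> monom \<Rightarrow> monom \<Rightarrow> bool"
  where "first_diff_greater ms u v \<longleftrightarrow>
    (\<exists>p<length ms. (\<forall>q<p. Poly_Mapping.lookup u (ms ! q) = Poly_Mapping.lookup v (ms ! q)) \<and>
      Poly_Mapping.lookup u (ms ! p) > Poly_Mapping.lookup v (ms ! p))"

definition prec :: "nat \<Rightarrow> nat \<Rightarrow> nat \<Rightarrow> nat \<Rightarrow> monom \<Rightarrow> monom \<Rightarrow> bool"
  where "prec a b n i u v \<longleftrightarrow>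
    wdeg a b n u < wdeg a b n v \<or>
    wdeg a b n u = wdeg a b n v \<and> first_diff_greater (var_list n i) u v"

lemma set_var_list: "i \<in> {1..n} \<Longrightarrow> set (var_list n i) = {1..n}"
  by (auto simp: var_list_def)

lemma first_diff_greater_trans:
  assumes "first_diff_greater ms u v" "first_diff_greater ms v w"
  shows "first_diff_greater ms u w"
proof -
  obtain p where p: "p < length ms"
    "\<forall>q<p. Poly_Mapping.lookup u (ms ! q) = Poly_Mapping.lookup v (ms ! q)"
    "Poly_Mapping.lookup u (ms ! p) > Poly_Mapping.lookup v (ms ! p)"
    using assms(1) unfolding first_diff_greater_def by blast
  obtain p' where p': "p' < length ms"
    "\<forall>q<p'. Poly_Mapping.lookup v (ms ! q) = Poly_Mapping.lookup w (ms ! q)"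
    "Poly_Mapping.lookup v (ms ! p') > Poly_Mapping.lookup w (ms ! p')"
    using assms(2) unfolding first_diff_greater_def by blast
  consider "p < p'" | "p = p'" | "p' < p" by linarith
  then show ?thesis
  proof cases
    case 1 then show ?thesis
      unfolding first_diff_greater_def using p p' by (intro exI[of _ p]) simp
  next
    case 2 then show ?thesis
      unfolding first_diff_greater_def using p p' by (intro exI[of _ p]) auto
  next
    case 3 then show ?thesis
      unfolding first_diff_greater_def using p p' by (intro exI[of _ p']) simp
  qed
qed

lemma first_diff_greater_total:
  assumes "m \<in> set ms" "Poly_Mapping.lookup u m \<noteq> Poly_Mapping.lookup v m"
  shows "first_diff_greater ms u v \<or> first_diff_greater ms v u"
proof -
  let ?P = "\<lambda>p. p < length ms \<and> Poly_Mapping.lookup u (ms ! p) \<noteq> Poly_Mapping.lookup v (ms ! p)"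
  have "\<exists>p. ?P p"
    using assms by (metis in_set_conv_nth)
  then obtain p where p: "?P p" "\<forall>q<p. \<not> ?P q"
    by (rule exists_least_iff[THEN iffD1, THEN exE]) blast
  then have eq: "\<forall>q<p. Poly_Mapping.lookup u (ms ! q) = Poly_Mapping.lookup v (ms ! q)"
    by auto
  then show ?thesis
    unfolding first_diff_greater_def using p(1) by (metis linorder_neqE_nat)
qed

lemma prec_term_order:
  assumes "b > 0" and "n > 1" and "i \<in> {1..n}"
  shows "term_order n (prec a b n i)"
proof -
  have wpos: "weight a b n j > 0" for j
  proof -
    have "b ^ 0 \<le> repunit b n"
      unfolding repunit_def using assms(2) by (intro member_le_sum) auto
    then show ?thesis by (simp add: weight_def)
  qed
  have neq: "\<exists>m\<in>{1..n}. Poly_Mapping.lookup u m \<noteq> Poly_Mapping.lookup v m"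
    if "u \<in> monoms n" "v \<in> monoms n" "u \<noteq> v" for u v
  proof -
    obtain m where m: "Poly_Mapping.lookup u m \<noteq> Poly_Mapping.lookup v m"
      using \<open>u \<noteq> v\<close> by (metis poly_mapping_eqI)
    then have "m \<in> Poly_Mapping.keys u \<or> m \<in> Poly_Mapping.keys v"
      by (metis in_keys_iff)
    then show ?thesis using that m by (auto simp: monoms_def)
  qed
  have zero: "wdeg a b n 0 < wdeg a b n u" if u: "u \<in> monoms n" "u \<noteq> 0" for u
  proof -
    obtain m where "m \<in> {1..n}" "Poly_Mapping.lookup u m \<noteq> 0"
      using neq[OF u(1) monoms_zero u(2)] by auto
    then have "wdeg a b n u > 0"
      unfolding wdeg_def using wpos by (intro sum_pos2[of _ m]) auto
    then show ?thesis by (simp add: wdeg_def)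
  qed
  have wadd: "wdeg a b n (u + w) = wdeg a b n u + wdeg a b n w" for u w
    by (simp add: wdeg_def lookup_add algebra_simps sum.distrib)
  show ?thesis
    unfolding term_order_def
  proof (intro conjI ballI impI)
    fix u show "\<not> prec a b n i u u" by (simp add: prec_def first_diff_greater_def)
  next
    fix u v w assume "prec a b n i u v" "prec a b n i v w"
    then show "prec a b n i u w"
      using first_diff_greater_trans[of "var_list n i" u v w] by (auto simp: prec_def)
  next
    fix u v assume "u \<in> monoms n" "v \<in> monoms n" "u \<noteq> v"
    then obtain m where "m \<in> set (var_list n i)" "Poly_Mapping.lookup u m \<noteq> Poly_Mapping.lookup v m"
      using neq set_var_list[OF assms(3)] by blast
    from first_diff_greater_total[OF this] show "prec a b n i u v \<or> prec a b n i v u"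
      unfolding prec_def by linarith
  next
    fix u assume "u \<in> monoms n" "u \<noteq> 0"
    then show "prec a b n i 0 u" using zero by (simp add: prec_def)
  next
    fix u v w assume "prec a b n i u v"
    then show "prec a b n i (u + w) (v + w)"
      by (auto simp: prec_def wadd first_diff_greater_def lookup_add)
  qed
qed


definition matX :: "nat \<Rightarrow> nat \<Rightarrow> nat \<Rightarrow> nat \<Rightarrow> nat \<Rightarrow> ('k::field) mpoly"
  where "matX a b n r c =
    (if r = 1 then var c ^ b else if c < n then var (c + 1) else var 1 ^ (a + 1))"

definition minors2 :: "nat \<Rightarrow> (nat \<Rightarrow> nat \<Rightarrow> ('k::field) mpoly) \<Rightarrow> 'k mpoly set"
  where "minors2 n M =
    {M 1 j * M 2 k - M 1 k * M 2 j | j k. j \<in> {1..n} \<and> k \<in> {1..n} \<and> j < k}"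

definition I2X :: "nat \<Rightarrow> nat \<Rightarrow> nat \<Rightarrow> ('k::field) mpoly set"
  where "I2X a b n = Idl\<^bsub>mpoly_ring n\<^esub> (minors2 n (matX a b n))"

(* Truncated subtraction is harmless in the index ranges below, since n > 1 and i > 0:
   for i = 1 the range {1..i - 2} is {1..0}, hence empty. *)

definition G1 :: "nat \<Rightarrow> nat \<Rightarrow> nat \<Rightarrow> ('k::field) mpoly set"
  where "G1 b n i = {var (j + 1) * var k ^ b - var j ^ b * var (k + 1) | j k.
    j \<in> {i..n - 2} \<and> k \<in> {j + 1..n - 1}}"

definition G2 :: "nat \<Rightarrow> nat \<Rightarrow> ('k::field) mpoly set"
  where "G2 b i = {var (j + 1) * var k ^ b - var j ^ b * var (k + 1) | j k.
    j \<in> {1..i - 2} \<and> k \<in> {j + 1..i - 1}}"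

definition G3 :: "nat \<Rightarrow> nat \<Rightarrow> nat \<Rightarrow> ('k::field) mpoly set"
  where "G3 b n i = {var j ^ b * var (k + 1) - var (j + 1) * var k ^ b | j k.
    j \<in> {1..i - 1} \<and> k \<in> {i..n - 1}}"

definition G4 :: "nat \<Rightarrow> nat \<Rightarrow> nat \<Rightarrow> nat \<Rightarrow> ('k::field) mpoly set"
  where "G4 a b n i =
    {var 1 ^ (a + 1) * var l ^ b - var (l + 1) * var n ^ b | l. l \<in> {1..i - 1}} \<union>
    {var (l + 1) * var n ^ b - var 1 ^ (a + 1) * var l ^ b | l. l \<in> {i..n - 1}}"

end

theory Submission
  imports Defs
begin

text \<open>
  All exponents are controlled by integer vectors \<open>lam\<close> indexed by the columns of the matrix.
  Write the column \<open>c\<close> as a monomial \<open>top c\<close> over a monomial \<open>bottom c\<close>. The minor of the columns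
  \<open>c\<close> and \<open>d\<close> is the difference of the monomials \<open>top c + bottom d\<close> and \<open>bottom c + top d\<close>
  (in exponent vectors), so the two monomials differ by an element of the lattice of all sums
  \<open>\<Sum>c. lam c * (top c - bottom c)\<close> with \<open>\<Sum>c. lam c = 0\<close>. Hence in every element of the ideal of
  minors the coefficients add up to zero over each class of monomials modulo this lattice
  (\<open>I2X_class_sum\<close>).

  Now rotate the columns into the order \<open>i, i + 1, ..., n, 1, ..., i - 1\<close>. The bottom entry of each
  column is then a power of the variable on top of the next column, and the variables increase from
  the first one, \<open>x\<^sub>i\<close>, to the last one and from there downwards to the second one. Let \<open>u\<close> and \<open>v\<close>
  differ by the vector \<open>lam\<close>. Two observations on the signs of \<open>lam\<close>, read along the rotated
  columns, prove everything:

  \<^item> If a negative entry of \<open>lam\<close> occurs before a positive one, then so does a pair with only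
    zeros in between, at \<open>p\<close> and \<open>q\<close> say. The entry at \<open>p\<close> forces the bottom of column \<open>p\<close> into
    \<open>u\<close>, the entry at \<open>q\<close> forces the top of column \<open>q\<close> into \<open>u\<close>, so \<open>u\<close> is divisible by the monomial
    \<open>bottom p + top q\<close> (\<open>standard_signs\<close>).
  \<^item> Otherwise all positive entries precede all negative ones. Unless \<open>lam = 0\<close>, comparing the
    exponents from the smallest variable on shows that \<open>u\<close> is smaller than \<open>v\<close>
    (\<open>displaced_prec\<close>); the weighted degrees agree because \<open>top c\<close> and \<open>bottom c\<close> differ in degree
    by the same amount for every \<open>c\<close>.

  The second observation identifies \<open>bottom p + top q\<close>, for \<open>p\<close> before \<open>q\<close>, as the leading monomial of
  the minor. Together they say that a monomial divisible by none of these is the smallest one in its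
  class (\<open>standard_prec\<close>). Such a monomial cannot lead an element of the ideal: it would be
  the only monomial of its class in that element, and the coefficient sum over the class would not
  vanish. So each leading monomial of the ideal is divisible by that of a minor
  (\<open>lead_monom_not_standard\<close>). Minimality and the number of elements come from
  \<open>lead_divides_lead\<close>: the leading monomials of minors of different pairs do not divide one another.
\<close>

section \<open>Coefficient sums over classes of monomials\<close>

definition class_sum :: "monom set \<Rightarrow> ('k::field) mpoly \<Rightarrow> 'k"
  where "class_sum C f = (\<Sum>v \<in> Poly_Mapping.keys f \<inter> C. Poly_Mapping.lookup f v)"

lemma class_sum_superset:
  assumes "finite S" and "Poly_Mapping.keys f \<subseteq> S"
  shows "class_sum C f = (\<Sum>v \<in> S \<inter> C. Poly_Mapping.lookup f v)"
  unfolding class_sum_def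
  by (rule sum.mono_neutral_left) (use assms in \<open>auto simp: in_keys_iff\<close>)

lemma class_sum_zero [simp]: "class_sum C 0 = 0"
  by (simp add: class_sum_def)

lemma class_sum_add: "class_sum C (f + g) = class_sum C f + class_sum C g"
proof -
  let ?S = "Poly_Mapping.keys f \<union> Poly_Mapping.keys g"
  have "class_sum C h = (\<Sum>v \<in> ?S \<inter> C. Poly_Mapping.lookup h v)"
    if "h \<in> {f, g, f + g}" for h
    by (rule class_sum_superset) (use that Poly_Mapping.keys_add[of f g] in auto)
  then show ?thesis by (simp add: lookup_add sum.distrib)
qed

lemma class_sum_uminus: "class_sum C (- f) = - class_sum C f"
  using class_sum_add[of C f "- f"] by (simp add: eq_neg_iff_add_eq_0 add.commute)

lemma class_sum_diff: "class_sum C (f - g) = class_sum C f - class_sum C g"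
  using class_sum_add[of C f "- g"] by (simp add: class_sum_uminus)

lemma class_sum_single: "class_sum C (Poly_Mapping.single u c) = (if u \<in> C then c else 0)"
  by (simp add: class_sum_def)

lemma mpoly_induct [case_names zero add_single]:
  assumes "P 0"
    and "\<And>f u c. P f \<Longrightarrow> P (f + Poly_Mapping.single u (c :: 'k :: field))"
  shows "P f"
proof (induction f rule: update_induct)
  case const
  then show ?case using assms(1) by simp
next
  case (update f u c)
  have "Poly_Mapping.update u c f = f + Poly_Mapping.single u c"
    by (rule poly_mapping_eqI)
      (use update in \<open>auto simp: lookup_update lookup_add lookup_single when_def in_keys_iff\<close>)
  then show ?case using assms(2) update.IH by simp
qed

lemma class_sum_times_single:
  "class_sum C (f * Poly_Mapping.single w c) = class_sum {v. v + w \<in> C} f * c"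
  by (induction f rule: mpoly_induct)
    (simp_all add: class_sum_add class_sum_single mult_single algebra_simps)

lemma carrier_mpoly_ring:
  "p \<in> carrier (mpoly_ring n) \<longleftrightarrow> Poly_Mapping.keys p \<subseteq> monoms n"
  by (simp add: mpoly_ring_def)

text \<open>
  Multiplication by a monomial embeds each class of a cancellative congruence into a class, and two
  different classes never land in the same one. So each coefficient sum of the product is zero or a
  multiple of a coefficient sum of the original polynomial.
\<close>

lemma class_sums_zero_ideal:
  fixes R :: "monom \<Rightarrow> monom \<Rightarrow> bool"
  assumes refl: "\<And>u. R u u" and sym: "\<And>u v. R u v \<Longrightarrow> R v u"
    and trans: "\<And>u v w. R u v \<Longrightarrow> R v w \<Longrightarrow> R u w"
    and add: "\<And>u v w. R (u + w) (v + w) \<longleftrightarrow> R u v"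
  shows "ideal {f \<in> carrier (mpoly_ring n :: ('k::field) mpoly ring).
           \<forall>u. class_sum {v. R v u} f = 0} (mpoly_ring n)"
    (is "ideal ?K ?P")
proof -
  interpret P: cring ?P by (rule mpoly_ring_cring)
  have neg: "\<ominus>\<^bsub>?P\<^esub> f = - f" if "f \<in> carrier ?P" for f
    by (rule P.minus_equality) (use that in \<open>auto simp: mpoly_ring_def\<close>)
  have single: "class_sum {v. R v u} (f * Poly_Mapping.single w c) = 0"
    if f: "\<forall>u. class_sum {v. R v u} f = 0" for f :: "'k mpoly" and u w c
  proof (cases "\<exists>v. R (v + w) u")
    case True
    then obtain v0 where v0: "R (v0 + w) u" by blast
    have "{v. R (v + w) u} = {v. R v v0}"
      using v0 add sym trans by blast
    then show ?thesis using f by (simp add: class_sum_times_single)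
  next
    case False
    then have "{v. v + w \<in> {v. R v u}} = {}" by simp
    then show ?thesis unfolding class_sum_times_single by (simp add: class_sum_def)
  qed
  have mult: "class_sum {v. R v u} (f * g) = 0"
    if f: "\<forall>u. class_sum {v. R v u} f = 0" for f g :: "'k mpoly" and u
    by (induction g rule: mpoly_induct)
      (simp_all add: distrib_left class_sum_add single[OF f])
  have closed: "f \<otimes>\<^bsub>?P\<^esub> g \<in> ?K" if "f \<in> ?K" "g \<in> carrier ?P" for f g
    using that P.m_closed[of f g] mult by (simp add: mpoly_ring_def)
  show ?thesis
  proof (rule idealI)
    show "subgroup ?K (add_monoid ?P)"
    proof (rule P.add.subgroupI)
      fix f assume "f \<in> ?K"
      then show "\<ominus>\<^bsub>?P\<^esub> f \<in> ?K"
        by (simp add: neg class_sum_uminus) (simp add: carrier_mpoly_ring)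
    next
      fix f g assume "f \<in> ?K" "g \<in> ?K"
      moreover from this have "f \<oplus>\<^bsub>?P\<^esub> g \<in> carrier ?P" by simp
      ultimately show "f \<oplus>\<^bsub>?P\<^esub> g \<in> ?K"
        by (simp add: mpoly_ring_def class_sum_add)
    qed (auto simp: carrier_mpoly_ring intro!: exI[of _ 0])
  next
    fix f g assume "f \<in> ?K" "g \<in> carrier ?P"
    then show "f \<otimes>\<^bsub>?P\<^esub> g \<in> ?K" and "g \<otimes>\<^bsub>?P\<^esub> f \<in> ?K"
      using closed[of f g] P.m_comm[of g f] by auto
  qed (rule P.ring_axioms)
qed

section \<open>Leading monomials for a term order\<close>

lemma term_order_trans:
  assumes "term_order n lt" and "u \<in> monoms n" "v \<in> monoms n" "w \<in> monoms n"
    and "lt u v" "lt v w"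
  shows "lt u w"
proof -
  have "\<forall>u\<in>monoms n. \<forall>v\<in>monoms n. \<forall>w\<in>monoms n. lt u v \<longrightarrow> lt v w \<longrightarrow> lt u w"
    using assms(1) unfolding term_order_def by (elim conjE)
  from this[rule_format, OF assms(2-6)] show ?thesis .
qed

lemma term_order_asym:
  assumes "term_order n lt" and "u \<in> monoms n" "v \<in> monoms n" and "lt u v"
  shows "\<not> lt v u"
proof
  assume "lt v u"
  with assms(4) have "lt u u" by (rule term_order_trans[OF assms(1-3,2)])
  moreover have "\<forall>u\<in>monoms n. \<not> lt u u"
    using assms(1) unfolding term_order_def by (elim conjE)
  ultimately show False using assms(2) by blast
qed

lemma lead_monom_eqI:
  assumes ord: "term_order n lt"
    and "Poly_Mapping.keys f \<subseteq> monoms n" and "u \<in> Poly_Mapping.keys f"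
    and "\<And>v. v \<in> Poly_Mapping.keys f \<Longrightarrow> v \<noteq> u \<Longrightarrow> lt v u"
  shows "lead_monom lt f = u"
  unfolding lead_monom_def
proof (rule the_equality)
  show "u \<in> Poly_Mapping.keys f \<and> (\<forall>v\<in>Poly_Mapping.keys f. v \<noteq> u \<longrightarrow> lt v u)"
    using assms(3,4) by simp
next
  fix w assume w: "w \<in> Poly_Mapping.keys f \<and> (\<forall>v\<in>Poly_Mapping.keys f. v \<noteq> w \<longrightarrow> lt v w)"
  show "w = u"
  proof (rule ccontr)
    assume "w \<noteq> u"
    then have "lt u w" "lt w u" using w assms(3,4) by auto
    then show False using term_order_asym[OF ord, of u w] w assms(2,3) by blast
  qed
qed

lemma term_order_finite_max:
  assumes ord: "term_order n lt" and "finite S" "S \<noteq> {}" "S \<subseteq> monoms n"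
  shows "\<exists>u\<in>S. \<forall>v\<in>S. v \<noteq> u \<longrightarrow> lt v u"
  using assms(2-)
proof (induction S rule: finite_ne_induct)
  case (singleton x)
  then show ?case by simp
next
  case (insert x S)
  then obtain u where u: "u \<in> S" "\<forall>v\<in>S. v \<noteq> u \<longrightarrow> lt v u" by auto
  have mem: "u \<in> monoms n" "x \<in> monoms n" "S \<subseteq> monoms n" using insert u by auto
  have "u \<noteq> x" using insert u by auto
  moreover have "\<forall>u\<in>monoms n. \<forall>v\<in>monoms n. u \<noteq> v \<longrightarrow> lt u v \<or> lt v u"
    using ord unfolding term_order_def by (elim conjE)
  ultimately consider "lt x u" | "lt u x"
    using mem by blast
  then show ?case
  proof cases
    case 1
    then show ?thesis using u by (intro bexI[of _ u]) auto
  next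
    case 2
    have "lt v x" if "v \<in> S" for v
      using term_order_trans[OF ord, of v u x] 2 u mem that by (cases "v = u") auto
    then show ?thesis by (intro bexI[of _ x]) auto
  qed
qed

lemma lead_monom_greatest:
  assumes ord: "term_order n lt" and "Poly_Mapping.keys f \<subseteq> monoms n" and "f \<noteq> 0"
  shows "lead_monom lt f \<in> Poly_Mapping.keys f"
    and "\<And>v. v \<in> Poly_Mapping.keys f \<Longrightarrow> v \<noteq> lead_monom lt f \<Longrightarrow> lt v (lead_monom lt f)"
proof -
  obtain u where "u \<in> Poly_Mapping.keys f" "\<forall>v\<in>Poly_Mapping.keys f. v \<noteq> u \<longrightarrow> lt v u"
    using term_order_finite_max[OF ord, of "Poly_Mapping.keys f"] assms by auto
  moreover from this have "lead_monom lt f = u"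
    using lead_monom_eqI[OF ord assms(2)] by blast
  ultimately show "lead_monom lt f \<in> Poly_Mapping.keys f"
    and "\<And>v. v \<in> Poly_Mapping.keys f \<Longrightarrow> v \<noteq> lead_monom lt f \<Longrightarrow> lt v (lead_monom lt f)"
    by auto
qed

section \<open>Congruence modulo the lattice of the minors\<close>

definition top_monom :: "nat \<Rightarrow> nat \<Rightarrow> monom"
  where "top_monom b c = Poly_Mapping.single c b"

definition bottom_monom :: "nat \<Rightarrow> nat \<Rightarrow> nat \<Rightarrow> monom"
  where "bottom_monom a n c =
    (if c < n then Poly_Mapping.single (c + 1) 1 else Poly_Mapping.single 1 (a + 1))"

lemma var_power: "var c ^ m = Poly_Mapping.single (Poly_Mapping.single c m) (1 :: 'k :: field)"
  by (induction m) (simp_all add: var_def mult_single flip: single_add)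

lemma matX_top: "matX a b n 1 c = Poly_Mapping.single (top_monom b c) (1 :: 'k :: field)"
  by (simp add: matX_def top_monom_def var_power)

lemma matX_bottom: "matX a b n 2 c = Poly_Mapping.single (bottom_monom a n c) (1 :: 'k :: field)"
  using var_power[of 1 "a + 1", where ?'k = 'k] var_power[of "c + 1" 1, where ?'k = 'k]
  by (simp add: matX_def bottom_monom_def)

text \<open>
  The exponent of \<open>x\<^sub>j\<close> in \<open>\<Sum>c. lam c * (top c - bottom c)\<close>: besides the top of column \<open>j\<close>, only
  the bottom of the preceding column contributes, where column \<open>n\<close> cyclically precedes column 1.
\<close>

definition displacement :: "nat \<Rightarrow> nat \<Rightarrow> nat \<Rightarrow> (nat \<Rightarrow> int) \<Rightarrow> nat \<Rightarrow> int"
  where "displacement a b n lam j =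
    int b * lam j - (if j = 1 then int (a + 1) * lam n else lam (j - 1))"

lemma displacement_add: "displacement a b n (\<lambda>j. lam j + mu j) j =
    displacement a b n lam j + displacement a b n mu j"
  by (simp add: displacement_def algebra_simps)

text \<open>
  The displacement is an exponent only at the indices \<open>1, ..., n\<close>, so other coordinates are left
  free. Monomials in \<open>x\<^sub>1, ..., x\<^sub>n\<close> are determined by the coordinates that are compared.
\<close>

definition displaced :: "nat \<Rightarrow> nat \<Rightarrow> nat \<Rightarrow> (nat \<Rightarrow> int) \<Rightarrow> monom \<Rightarrow> monom \<Rightarrow> bool"
  where "displaced a b n lam u v \<longleftrightarrow>
    (\<Sum>j=1..n. lam j) = 0 \<and>
    (\<forall>j\<in>{1..n}. int (Poly_Mapping.lookup u j) =
      int (Poly_Mapping.lookup v j) + displacement a b n lam j)"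

definition lattice_cong :: "nat \<Rightarrow> nat \<Rightarrow> nat \<Rightarrow> monom \<Rightarrow> monom \<Rightarrow> bool"
  where "lattice_cong a b n u v \<longleftrightarrow> (\<exists>lam. displaced a b n lam u v)"

lemma lattice_cong_refl: "lattice_cong a b n u u"
  unfolding lattice_cong_def
  by (rule exI[of _ "\<lambda>_. 0"]) (simp add: displaced_def displacement_def)

lemma lattice_cong_sym:
  assumes "lattice_cong a b n u v" shows "lattice_cong a b n v u"
proof -
  obtain lam where "displaced a b n lam u v" using assms by (auto simp: lattice_cong_def)
  then have "displaced a b n (\<lambda>j. - lam j) v u"
    by (auto simp: displaced_def displacement_def sum_negf)
  then show ?thesis by (auto simp: lattice_cong_def)
qed

lemma lattice_cong_trans:
  assumes "lattice_cong a b n u v" and "lattice_cong a b n v w"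
  shows "lattice_cong a b n u w"
proof -
  obtain lam mu where "displaced a b n lam u v" "displaced a b n mu v w"
    using assms by (auto simp: lattice_cong_def)
  then have "displaced a b n (\<lambda>j. lam j + mu j) u w"
    by (simp add: displaced_def displacement_add sum.distrib)
  then show ?thesis by (auto simp: lattice_cong_def)
qed

lemma lattice_cong_add: "lattice_cong a b n (u + w) (v + w) \<longleftrightarrow> lattice_cong a b n u v"
  by (simp add: lattice_cong_def displaced_def lookup_add)

lemma displaced_minor:
  assumes "c \<in> {1..n}" "d \<in> {1..n}"
  shows "displaced a b n (\<lambda>j. of_bool (j = d) - of_bool (j = c))
    (bottom_monom a n c + top_monom b d) (top_monom b c + bottom_monom a n d)"
proof -
  have bot: "int (Poly_Mapping.lookup (bottom_monom a n c) j)
      = (if j = 1 then int (a + 1) * of_bool (n = c) else of_bool (j - 1 = c))"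
    if "c \<in> {1..n}" "j \<in> {1..n}" for c j
    using that by (auto simp: bottom_monom_def lookup_single when_def)
  have top: "int (Poly_Mapping.lookup (top_monom b c) j) = int b * of_bool (j = c)" for c j
    by (auto simp: top_monom_def lookup_single when_def)
  have sum: "(\<Sum>j=1..n. of_bool (j = c)) = (1 :: int)" if "c \<in> {1..n}" for c
    using that by (simp add: of_bool_def)
  show ?thesis
    using sum[OF assms(1)] sum[OF assms(2)]
    by (auto simp: displaced_def displacement_def lookup_add bot[OF assms(1)] bot[OF assms(2)]
        top sum_subtractf algebra_simps)
qed

text \<open>
  The recursion \<open>b * repunit b m + 1 = repunit b (m + 1)\<close> is what makes the minors homogeneous: the
  degrees of top and bottom entry differ by an amount that does not depend on the column.
\<close>

lemma weight_step:
  assumes "j \<ge> 1"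
  shows "int b * int (weight a b n j) =
    int (weight a b n (j + 1)) + (int b - 1) * int (repunit b n) - int a"
proof -
  have "b * repunit b m + 1 = repunit b (Suc m)" for m
    by (simp add: repunit_def sum.lessThan_Suc_shift sum_distrib_left del: sum.lessThan_Suc)
  from this[of "j - 1"] have "int b * int (repunit b (j - 1)) = int (repunit b j) - 1"
    using assms by (simp add: algebra_simps flip: of_nat_mult)
  then have "int a * (int b * int (repunit b (j - 1))) = int a * (int (repunit b j) - 1)"
    by simp
  then show ?thesis by (simp add: weight_def algebra_simps)
qed

lemma weight_last_step:
  assumes "n \<ge> 1"
  shows "int b * int (weight a b n n) =
    int (a + 1) * int (weight a b n 1) + (int b - 1) * int (repunit b n) - int a"
proof -
  have "weight a b n (n + 1) = (a + 1) * repunit b n" by (simp add: weight_def)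
  moreover have "weight a b n 1 = repunit b n" by (simp add: weight_def repunit_def)
  ultimately show ?thesis using weight_step[OF assms, of b a n] by (simp only: of_nat_mult)
qed

text \<open>
  The degree of \<open>\<Sum>c. lam c * (top c - bottom c)\<close> is the common degree difference of the
  columns times \<open>\<Sum>c. lam c\<close>, hence zero.
\<close>

lemma displaced_wdeg_eq:
  assumes "n \<ge> 1" and "displaced a b n lam u v"
  shows "wdeg a b n u = wdeg a b n v"
proof -
  let ?w = "\<lambda>j. int (weight a b n j)"
  let ?c = "(int b - 1) * int (repunit b n) - int a"
  have prev: "(\<Sum>j=1..n. ?w j * (if j = 1 then int (a + 1) * lam n else lam (j - 1)))
      = (\<Sum>j=1..n. (int b * ?w j - ?c) * lam j)"
  proof -
    obtain m where n: "n = Suc m" using assms(1) by (cases n) auto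
    have "(\<Sum>j=1..n. ?w j * (if j = 1 then int (a + 1) * lam n else lam (j - 1)))
        = ?w 1 * (int (a + 1) * lam n) + (\<Sum>j=1..m. ?w (Suc j) * lam j)"
      unfolding n by (subst sum.atLeast_Suc_atMost, simp, subst sum.shift_bounds_cl_Suc_ivl)
        (auto intro!: sum.cong)
    also have "?w 1 * (int (a + 1) * lam n) = (int b * ?w n - ?c) * lam n"
      using weight_last_step[OF assms(1), of b a] by (simp add: algebra_simps)
    also have "(\<Sum>j=1..m. ?w (Suc j) * lam j) = (\<Sum>j=1..m. (int b * ?w j - ?c) * lam j)"
      by (intro sum.cong refl) (simp add: weight_step)
    finally show ?thesis by (simp add: n)
  qed
  have "int (wdeg a b n u) = (\<Sum>j=1..n. ?w j * (int (Poly_Mapping.lookup v j) +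
      displacement a b n lam j))"
    unfolding wdeg_def of_nat_sum by (rule sum.cong) (use assms(2) in \<open>auto simp: displaced_def\<close>)
  also have "\<dots> = int (wdeg a b n v) + ((\<Sum>j=1..n. ?w j * (int b * lam j))
      - (\<Sum>j=1..n. ?w j * (if j = 1 then int (a + 1) * lam n else lam (j - 1))))"
    unfolding displacement_def wdeg_def of_nat_sum of_nat_mult
    by (simp only: right_diff_distrib distrib_left sum.distrib sum_subtractf)
  also have "\<dots> = int (wdeg a b n v) + (\<Sum>j=1..n. ?c * lam j)"
    unfolding prev sum_subtractf[symmetric]
    by (intro arg_cong2[where f = "(+)"] sum.cong refl) (simp add: algebra_simps)
  also have "(\<Sum>j=1..n. ?c * lam j) = 0"
    using assms(2) by (simp add: displaced_def flip: sum_distrib_left)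
  finally show ?thesis by simp
qed

section \<open>The matrix with rotated columns\<close>

locale rotated_columns =
  fixes a b n i :: nat
  assumes b_pos: "b > 0" and n_gt_1: "n > 1" and i_range: "i \<in> {1..n}"
begin

text \<open>
  The column at position \<open>p\<close>, counted from 0, of the rotated matrix. Position \<open>n\<close> is meaningful
  too and returns to column \<open>i\<close>, so that the successor of a position never needs to be reduced
  modulo \<open>n\<close>.
\<close>

definition cyc :: "nat \<Rightarrow> nat"
  where "cyc p = (if p \<le> n - i then i + p else i + p - n)"

definition bottom_exp :: "nat \<Rightarrow> nat"
  where "bottom_exp p = (if cyc p = n then a + 1 else 1)"

definition lead :: "nat \<Rightarrow> nat \<Rightarrow> monom"
  where "lead p q = bottom_monom a n (cyc p) + top_monom b (cyc q)"

definition trail :: "nat \<Rightarrow> nat \<Rightarrow> monom"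
  where "trail p q = top_monom b (cyc p) + bottom_monom a n (cyc q)"

lemma cyc_range: "p \<le> n \<Longrightarrow> cyc p \<in> {1..n}"
  using i_range by (auto simp: cyc_def)

lemma cyc_n: "cyc n = cyc 0"
  using i_range by (auto simp: cyc_def)

lemma cyc_inj0: "inj_on cyc {..<n}"
  using i_range by (auto simp: inj_on_def cyc_def split: if_splits)

lemma cyc_inj1: "inj_on cyc {1..n}"
  using i_range by (auto simp: inj_on_def cyc_def split: if_splits)

lemma cyc_bij: "bij_betw cyc {..<n} {1..n}"
proof -
  have "cyc ` {..<n} = {1..n}"
  proof (rule card_subset_eq)
    show "cyc ` {..<n} \<subseteq> {1..n}" using cyc_range by (meson image_subsetI lessThan_iff less_imp_le)
    show "card (cyc ` {..<n}) = card {1..n}" using card_image[OF cyc_inj0] by simp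
  qed simp
  then show ?thesis using cyc_inj0 by (simp add: bij_betw_def)
qed

lemma cyc_surj: "j \<in> {1..n} \<Longrightarrow> \<exists>p<n. j = cyc p"
  using bij_betw_imp_surj_on[OF cyc_bij] by blast

lemma cyc_Suc: "p < n \<Longrightarrow> cyc (Suc p) = (if cyc p = n then 1 else cyc p + 1)"
  using i_range by (auto simp: cyc_def)

lemma bottom_monom_cyc:
  assumes "p < n" shows "bottom_monom a n (cyc p) = Poly_Mapping.single (cyc (Suc p)) (bottom_exp p)"
  using cyc_range[of p] cyc_Suc[OF assms] assms by (auto simp: bottom_monom_def bottom_exp_def)

lemma displacement_cyc:
  assumes "p < n"
  shows "displacement a b n lam (cyc (Suc p)) =
    int b * lam (cyc (Suc p)) - int (bottom_exp p) * lam (cyc p)"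
  using cyc_range[of p] cyc_Suc[OF assms] assms n_gt_1
  by (auto simp: displacement_def bottom_exp_def)

lemma lookup_lead:
  assumes "p < q" "q < n" "r \<in> {1..n}"
  shows "Poly_Mapping.lookup (lead p q) (cyc r) =
    (if r = Suc p then bottom_exp p else 0) + (if r = q then b else 0)"
proof -
  have "cyc (Suc p) = cyc r \<longleftrightarrow> Suc p = r" "cyc q = cyc r \<longleftrightarrow> q = r"
    by (rule inj_on_eq_iff[OF cyc_inj1]; use assms in simp)+
  then show ?thesis
    using assms by (simp add: lead_def top_monom_def bottom_monom_cyc lookup_add lookup_single when_def)
qed

text \<open>
  The list of variables runs through the rotated columns backwards, starting from position \<open>n\<close>, which
  stands for position 0.
\<close>

lemma var_list_nth:
  assumes "t < n" shows "var_list n i ! t = cyc (n - t)"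
  using assms i_range
  by (auto simp: var_list_def cyc_def nth_append rev_nth simp del: upt_Suc)

lemma length_var_list: "length (var_list n i) = n"
  using i_range by (simp add: var_list_def)

lemma lead_monoms: "p < n \<Longrightarrow> q < n \<Longrightarrow> lead p q \<in> monoms n"
  using cyc_range[of "Suc p"] cyc_range[of q] unfolding lead_def
  by (intro monoms_add) (auto simp: monoms_def bottom_monom_cyc top_monom_def)

lemma trail_monoms: "p < n \<Longrightarrow> q < n \<Longrightarrow> trail p q \<in> monoms n"
  using cyc_range[of "Suc q"] cyc_range[of p] unfolding trail_def
  by (intro monoms_add) (auto simp: monoms_def bottom_monom_cyc top_monom_def)

text \<open>
  Let all positive entries of \<open>lam\<close> precede all negative ones and let \<open>N\<close> be the position of the last
  negative entry. If the entry at position 0 is positive, \<open>u\<close> exceeds \<open>v\<close> in the smallest variable,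
  since the column that precedes it cyclically contributes nothing negative. Otherwise the
  entries at \<open>N + 1, ..., n\<close> vanish, so going up from the smallest variable \<open>u\<close> and \<open>v\<close> agree until
  the variable at position \<open>N + 1\<close>, where the bottom of column \<open>N\<close> makes \<open>u\<close> larger.
\<close>

lemma displaced_prec:
  assumes disp: "displaced a b n lam u v"
    and nonzero: "\<exists>j\<in>{1..n}. lam j \<noteq> 0"
    and signs: "\<And>p q. p < q \<Longrightarrow> q < n \<Longrightarrow> lam (cyc p) < 0 \<Longrightarrow> lam (cyc q) > 0 \<Longrightarrow> False"
  shows "prec a b n i u v"
proof -
  define mu where "mu p = lam (cyc p)" for p
  have sum0: "(\<Sum>p<n. mu p) = 0"
    using disp sum.reindex_bij_betw[OF cyc_bij, of lam] by (simp add: displaced_def mu_def)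
  have nz: "\<exists>p<n. mu p \<noteq> 0"
    using nonzero cyc_surj by (metis mu_def)
  \<comment> \<open>Since the entries add up to zero without all vanishing, both signs occur.\<close>
  obtain P where P: "P < n" "mu P > 0"
  proof (rule ccontr)
    assume "\<not> thesis"
    then have "\<forall>p\<in>{..<n}. - mu p \<ge> 0" using that by force
    moreover have "(\<Sum>p<n. - mu p) = 0" using sum0 by (simp add: sum_negf)
    ultimately have "\<forall>p\<in>{..<n}. - mu p = 0" using sum_nonneg_eq_0_iff[of "{..<n}" "\<lambda>p. - mu p"] by blast
    then show False using nz by auto
  qed
  obtain N0 where N0: "N0 < n" "mu N0 < 0"
  proof (rule ccontr)
    assume "\<not> thesis"
    then have "\<forall>p\<in>{..<n}. mu p \<ge> 0" using that by force
    then have "\<forall>p\<in>{..<n}. mu p = 0" using sum0 sum_nonneg_eq_0_iff[of "{..<n}" mu] by blast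
    then show False using nz by auto
  qed
  define N where "N = Max {p. p < n \<and> mu p < 0}"
  have fin: "finite {p. p < n \<and> mu p < 0}" by simp
  have N: "N < n" "mu N < 0"
    using Max_in[OF fin] N0 unfolding N_def by blast+
  have N_last: "mu p \<ge> 0" if "N < p" "p < n" for p
    using Max_ge[OF fin, of p, folded N_def] that by (cases "mu p < 0") auto
  have "P < N"
  proof (rule ccontr)
    assume "\<not> P < N"
    moreover have "P \<noteq> N" using P N by auto
    ultimately show False using signs[of N P] P N by (simp add: mu_def)
  qed
  have after: "mu p = 0" if "N < p" "p < n" for p
  proof (rule ccontr)
    assume "mu p \<noteq> 0"
    then have "mu p > 0" using N_last[OF that] by simp
    then show False using signs[of N p] N that by (simp add: mu_def)
  qed
  have mu0: "mu 0 \<ge> 0"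
  proof (rule ccontr)
    assume neg: "\<not> mu 0 \<ge> 0"
    then have "P > 0" using P by (cases P) auto
    then show False using signs[of 0 P] P neg by (simp add: mu_def)
  qed
  have mu_n: "mu n = mu 0" by (simp add: mu_def cyc_n)
  have coord: "int (Poly_Mapping.lookup u (cyc (Suc p))) = int (Poly_Mapping.lookup v (cyc (Suc p)))
      + (int b * mu (Suc p) - int (bottom_exp p) * mu p)" if "p < n" for p
    using disp cyc_range[of "Suc p"] displacement_cyc[OF that, of lam] that
    by (simp add: displaced_def mu_def)
  have drop: "int (bottom_exp N) * mu N < 0"
    using N(2) by (simp add: bottom_exp_def mult_pos_neg)
  have "first_diff_greater (var_list n i) u v"
  proof (cases "mu 0 = 0")
    case True
    have zero: "mu p = 0" if "N < p" "p \<le> n" for p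
      using after[of p] that True mu_n by (cases "p = n") auto
    have eq: "Poly_Mapping.lookup u (cyc p) = Poly_Mapping.lookup v (cyc p)"
      if "Suc N < p" "p \<le> n" for p
      using coord[of "p - 1"] zero[of p] zero[of "p - 1"] that by simp
    have gt: "Poly_Mapping.lookup u (cyc (Suc N)) > Poly_Mapping.lookup v (cyc (Suc N))"
      using coord[of N] zero[of "Suc N"] N drop by simp
    show ?thesis
      unfolding first_diff_greater_def length_var_list
      by (rule exI[of _ "n - Suc N"]) (use N eq gt in \<open>auto simp: var_list_nth\<close>)
  next
    case False
    have "mu (n - 1) \<le> 0"
      using after[of "n - 1"] N by (cases "N = n - 1") auto
    then have "int (bottom_exp (n - 1)) * mu (n - 1) \<le> 0" by (simp add: mult_nonneg_nonpos)
    moreover have "int b * mu n > 0" using False mu0 mu_n b_pos by simp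
    ultimately have "Poly_Mapping.lookup u (cyc n) > Poly_Mapping.lookup v (cyc n)"
      using coord[of "n - 1"] n_gt_1 by simp
    then show ?thesis
      unfolding first_diff_greater_def length_var_list
      by (intro exI[of _ 0]) (use n_gt_1 in \<open>auto simp: var_list_nth\<close>)
  qed
  moreover have "wdeg a b n u = wdeg a b n v"
    using displaced_wdeg_eq[OF _ disp] n_gt_1 by simp
  ultimately show ?thesis by (simp add: prec_def)
qed

text \<open>
  The monomials outside the ideal generated by the leading monomials of the minors.
\<close>

definition standard :: "monom \<Rightarrow> bool"
  where "standard u \<longleftrightarrow> (\<forall>p q w. p < q \<longrightarrow> q < n \<longrightarrow> u \<noteq> lead p q + w)"

lemma lead_divides:
  assumes pq: "p < q" "q < n"
    and le: "\<And>r. r \<in> {1..n} \<Longrightarrow> Poly_Mapping.lookup (lead p q) (cyc r) \<le> Poly_Mapping.lookup u (cyc r)"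
  shows "u = lead p q + (u - lead p q)"
proof (rule poly_mapping_eqI)
  fix j
  have "Poly_Mapping.lookup (lead p q) j \<le> Poly_Mapping.lookup u j"
  proof (cases "j \<in> {1..n}")
    case True
    then obtain r where "r < n" "j = cyc r"
      using cyc_surj by blast
    then show ?thesis using le[of r] le[of n] cyc_n pq by (cases "r = 0") auto
  next
    case False
    then have "j \<notin> Poly_Mapping.keys (lead p q)"
      using lead_monoms[of p q] pq by (auto simp: monoms_def)
    then show ?thesis by (simp add: in_keys_iff)
  qed
  then show "Poly_Mapping.lookup u j = Poly_Mapping.lookup (lead p q + (u - lead p q)) j"
    by (simp add: lookup_add lookup_minus)
qed

text \<open>
  Descent on the distance of \<open>p\<close> and \<open>q\<close>: a nonzero entry in between gives a closer pair of opposite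
  signs. With zeros only in between, the exponents of \<open>u\<close> forced at \<open>p + 1\<close> and at \<open>q\<close>
  do not interfere, and if \<open>p + 1 = q\<close> they add up.
\<close>

lemma standard_signs:
  assumes std: "standard u" and disp: "displaced a b n lam u v"
    and pq: "p < q" "q < n" and neg: "lam (cyc p) < 0" and pos: "lam (cyc q) > 0"
  shows False
  using pq neg pos
proof (induction "q - p" arbitrary: p q rule: less_induct)
  case less
  show False
  proof (cases "\<exists>r. p < r \<and> r < q \<and> lam (cyc r) \<noteq> 0")
    case True
    then obtain r where r: "p < r" "r < q" "lam (cyc r) \<noteq> 0" by blast
    show False
    proof (cases "lam (cyc r) > 0")
      case True
      then show False using less.hyps[of r p] less.prems r by (simp add: diff_less_mono)
    next
      case False
      then show False using less.hyps[of q r] less.prems r by (simp add: diff_less_mono2)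
    qed
  next
    case False
    have coord: "int (Poly_Mapping.lookup u (cyc (Suc r))) \<ge>
      int b * lam (cyc (Suc r)) - int (bottom_exp r) * lam (cyc r)" if "r < n" for r
      using disp cyc_range[of "Suc r"] displacement_cyc[OF that, of lam] that
      by (simp add: displaced_def)
    have top: "int b * lam (cyc q) \<ge> int b"
      using mult_left_mono[of 1 "lam (cyc q)" "int b"] less.prems by simp
    have bot: "- (int (bottom_exp p) * lam (cyc p)) \<ge> int (bottom_exp p)"
      using mult_left_mono[of 1 "- lam (cyc p)" "int (bottom_exp p)"] less.prems by simp
    have "Poly_Mapping.lookup (lead p q) (cyc r) \<le> Poly_Mapping.lookup u (cyc r)"
      if "r \<in> {1..n}" for r
    proof (cases "Suc p = q")
      case True
      then show ?thesis
        using coord[of p] top bot less.prems that by (simp add: lookup_lead)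
    next
      case sep: False
      have "lam (cyc (Suc p)) = 0" and "lam (cyc (q - 1)) = 0"
        using False sep less.prems by auto
      then have "Poly_Mapping.lookup u (cyc (Suc p)) \<ge> bottom_exp p"
        and "Poly_Mapping.lookup u (cyc q) \<ge> b"
        using coord[of p] coord[of "q - 1"] top bot less.prems(1,2)
        by (simp_all add: less_imp_diff_less)
      then show ?thesis using less.prems that sep by (simp add: lookup_lead)
    qed
    then show False
      using lead_divides[of p q u] std less.prems unfolding standard_def by blast
  qed
qed

text \<open>
  A standard \<open>u\<close> excludes a negative entry before a positive one, whatever \<open>v\<close> is, so
  it is the least monomial of its class.
\<close>

lemma standard_prec:
  assumes "standard u" "u \<in> monoms n" "v \<in> monoms n" "u \<noteq> v" "lattice_cong a b n u v"
  shows "prec a b n i u v"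
proof -
  obtain lam where disp: "displaced a b n lam u v"
    using assms(5) by (auto simp: lattice_cong_def)
  have "\<exists>j\<in>{1..n}. lam j \<noteq> 0"
  proof (rule ccontr)
    assume zero: "\<not> ?thesis"
    have "Poly_Mapping.lookup u j = Poly_Mapping.lookup v j" for j
    proof (cases "j \<in> {1..n}")
      case True
      have lam0: "lam m = 0" if "m \<in> {1..n}" for m using zero that by blast
      have "lam (j - 1) = 0" if "j \<noteq> 1"
        by (rule lam0) (use True that in auto)
      then have "displacement a b n lam j = 0"
        using lam0[of j] lam0[of n] True n_gt_1 by (simp add: displacement_def)
      moreover have "int (Poly_Mapping.lookup u j) =
          int (Poly_Mapping.lookup v j) + displacement a b n lam j"
        using disp True unfolding displaced_def by blast
      ultimately show ?thesis by simp
    next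
      case False
      then have "j \<notin> Poly_Mapping.keys u" "j \<notin> Poly_Mapping.keys v"
        using assms(2,3) unfolding monoms_def by auto
      then show ?thesis by (simp add: in_keys_iff)
    qed
    then show False using assms(4) poly_mapping_eqI by blast
  qed
  with disp show ?thesis
    by (rule displaced_prec) (use standard_signs[OF assms(1) disp] in blast)
qed

text \<open>
  The two monomials of a minor differ by the vector that is 1 at \<open>p\<close>, -1 at \<open>q\<close> and 0
  elsewhere, whose positive entry comes first.
\<close>

lemma trail_prec_lead:
  assumes "p < q" "q < n"
  shows "prec a b n i (trail p q) (lead p q)"
proof -
  have neq: "cyc p \<noteq> cyc q" and range: "cyc p \<in> {1..n}" "cyc q \<in> {1..n}"
    using inj_onD[OF cyc_inj0, of p q] cyc_range[of p] cyc_range[of q] assms by auto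
  have "displaced a b n (\<lambda>j. of_bool (j = cyc p) - of_bool (j = cyc q)) (trail p q) (lead p q)"
    using displaced_minor[OF range(2,1), of a b]
    by (simp add: trail_def lead_def add.commute)
  then show ?thesis
  proof (rule displaced_prec)
    show "\<exists>j\<in>{1..n}. of_bool (j = cyc p) - of_bool (j = cyc q) \<noteq> (0 :: int)"
      using range neq by (intro bexI[of _ "cyc p"]) auto
  next
    fix r s assume rs: "r < s" "s < n"
      and "of_bool (cyc r = cyc p) - of_bool (cyc r = cyc q) < (0 :: int)"
      and "of_bool (cyc s = cyc p) - of_bool (cyc s = cyc q) > (0 :: int)"
    then have "cyc r = cyc q" "cyc s = cyc p"
      by (auto simp: of_bool_def split: if_splits)
    then have "r = q" "s = p"
      using inj_onD[OF cyc_inj0, of r q] inj_onD[OF cyc_inj0, of s p] rs assms by auto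
    then show False using rs assms by simp
  qed
qed

text \<open>
  The monomial \<open>lead r s\<close> involves the variables at positions \<open>r + 1\<close> and \<open>s\<close>, where
  \<open>r + 1 \<le> s\<close>; these positions, and if they coincide the size of the exponent, determine \<open>r\<close>
  and \<open>s\<close>.
\<close>

lemma lead_divides_lead:
  assumes pq: "p < q" "q < n" and rs: "r < s" "s < n" and div: "lead r s = lead p q + w"
  shows "r = p \<and> s = q"
proof -
  have le: "(if t = Suc p then bottom_exp p else 0) + (if t = q then b else 0) \<le>
      (if t = Suc r then bottom_exp r else 0) + (if t = s then b else 0)" if "t \<in> {1..n}" for t
  proof -
    have "Poly_Mapping.lookup (lead p q) (cyc t) \<le> Poly_Mapping.lookup (lead r s) (cyc t)"
      unfolding div by (simp add: lookup_add)
    then show ?thesis using that pq rs by (simp only: lookup_lead)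
  qed
  have pos: "bottom_exp t > 0" for t by (simp add: bottom_exp_def)
  show ?thesis
    using le[of "Suc p"] le[of q] pos[of p] pos[of r] b_pos pq rs
    by (auto split: if_splits)
qed


section \<open>The minors and their leading monomials\<close>

lemma prec_order: "term_order n (prec a b n i)"
  using prec_term_order b_pos n_gt_1 i_range by blast

definition minor :: "nat \<Rightarrow> nat \<Rightarrow> ('k::field) mpoly"
  where "minor p q = Poly_Mapping.single (lead p q) 1 - Poly_Mapping.single (trail p q) 1"

lemma lead_neq_trail:
  assumes "p < q" "q < n"
  shows "lead p q \<noteq> trail p q"
proof
  assume "lead p q = trail p q"
  then have "prec a b n i (lead p q) (lead p q)" using trail_prec_lead[OF assms] by simp
  moreover have "lead p q \<in> monoms n" using lead_monoms assms by simp
  ultimately show False using term_order_asym[OF prec_order, of "lead p q" "lead p q"]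
    by simp
qed

lemma keys_minor:
  assumes "p < q" "q < n"
  shows "Poly_Mapping.keys (minor p q :: ('k::field) mpoly) = {lead p q, trail p q}"
proof (rule Set.set_eqI)
  fix v
  show "v \<in> Poly_Mapping.keys (minor p q :: 'k mpoly) \<longleftrightarrow> v \<in> {lead p q, trail p q}"
    using lead_neq_trail[OF assms]
    by (cases "v = lead p q"; cases "v = trail p q")
      (simp_all add: minor_def in_keys_iff lookup_minus lookup_single when_def)
qed

lemma minor_carrier:
  assumes "p < q" "q < n"
  shows "(minor p q :: ('k::field) mpoly) \<in> carrier (mpoly_ring n)"
  using keys_minor[OF assms, where ?'k = 'k] lead_monoms[of p q] trail_monoms[of p q] assms
  by (simp add: carrier_mpoly_ring)

lemma lead_monom_minor:
  assumes "p < q" "q < n"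
  shows "lead_monom (prec a b n i) (minor p q :: ('k::field) mpoly) = lead p q"
proof (rule lead_monom_eqI[OF prec_order])
  show "Poly_Mapping.keys (minor p q :: 'k mpoly) \<subseteq> monoms n"
    using minor_carrier[OF assms] unfolding carrier_mpoly_ring .
qed (use trail_prec_lead[OF assms] in \<open>auto simp: keys_minor[OF assms]\<close>)

lemma lead_coef_minor:
  assumes "p < q" "q < n"
  shows "lead_coef (prec a b n i) (minor p q :: ('k::field) mpoly) = 1"
  using lead_neq_trail[OF assms]
  by (simp add: lead_coef_def lead_monom_minor[OF assms])
    (simp add: minor_def lookup_minus lookup_single when_def)

lemma lead_term_minor:
  assumes "p < q" "q < n"
  shows "lead_term (prec a b n i) (minor p q :: ('k::field) mpoly) =
    Poly_Mapping.single (lead p q) 1"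
  by (simp add: lead_term_def lead_monom_minor[OF assms] lead_coef_minor[OF assms])

lemma minor_nonzero: "p < q \<Longrightarrow> q < n \<Longrightarrow> minor p q \<noteq> (0 :: ('k::field) mpoly)"
  using keys_minor[of p q, where ?'k = 'k] by fastforce

text \<open>
  Indexing by positions in the rotated matrix puts the signs of all four families into the single
  condition \<open>p < q\<close>.
\<close>

definition signed_minors :: "('k::field) mpoly set"
  where "signed_minors = (\<lambda>(p, q). minor p q) ` {(p, q). p < q \<and> q < n}"

lemma minor_inj: "inj_on (\<lambda>(p, q). minor p q :: ('k::field) mpoly) {(p, q). p < q \<and> q < n}"
proof (rule inj_onI, clarify)
  fix p q r s assume *: "p < q" "q < n" "r < s" "s < n"
    and "minor p q = (minor r s :: 'k mpoly)"
  then have "lead p q = lead r s" using lead_monom_minor by metis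
  then show "p = r \<and> q = s" using lead_divides_lead[of r s p q 0] * by simp
qed

lemma finite_pairs: "finite {(p, q). p < q \<and> q < (n :: nat)}"
  by (rule finite_subset[of _ "{..<n} \<times> {..<n}"]) auto

lemma card_pairs: "card {(p, q). p < q \<and> q < (m :: nat)} = m choose 2"
proof (induction m)
  case (Suc m)
  have split: "{(p, q). p < q \<and> q < Suc m} = {(p, q). p < q \<and> q < m} \<union> {..<m} \<times> {m}"
    by auto
  have "finite {(p, q). p < q \<and> q < m}"
    by (rule finite_subset[of _ "{..<m} \<times> {..<m}"]) auto
  then have "card {(p, q). p < q \<and> q < Suc m} = (m choose 2) + m"
    unfolding split by (subst card_Un_disjoint) (auto simp: Suc.IH)
  also have "\<dots> = Suc m choose 2" by (simp add: numeral_2_eq_2)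
  finally show ?case .
qed simp

lemma card_signed_minors: "card (signed_minors :: ('k::field) mpoly set) = n choose 2"
  unfolding signed_minors_def by (simp add: card_image[OF minor_inj] card_pairs)

lemma minor_matX: "minor p q = (matX a b n 2 (cyc p) * matX a b n 1 (cyc q)
    - matX a b n 1 (cyc p) * matX a b n 2 (cyc q) :: ('k::field) mpoly)"
  unfolding minor_def lead_def trail_def matX_top matX_bottom by (simp add: mult_single)

text \<open>
  The first two families consist of the pairs of columns on the same side of the cut before column
  \<open>i\<close>, in increasing order; the third one of the pairs across the cut, with the larger column first.
  The fourth one supplies the pairs that contain column \<open>n\<close>, whose bottom entry \<open>x\<^sub>1\<^sup>a\<^sup>+\<^sup>1\<close> is exceptional.
\<close>

lemma G_eq_minors_by_column:
  "G1 b n i \<union> G2 b i \<union> G3 b n i \<union> G4 a b n i =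
    {matX a b n 2 c * matX a b n 1 d - matX a b n 1 c * matX a b n 2 d :: ('k::field) mpoly | c d.
      c \<in> {1..n} \<and> d \<in> {1..n} \<and> (i \<le> c \<and> c < d \<or> c < d \<and> d < i \<or> d < i \<and> i \<le> c)}"
    (is "?L = ?R")
proof
  define M :: "nat \<Rightarrow> nat \<Rightarrow> 'k mpoly"
    where "M c d = matX a b n 2 c * matX a b n 1 d - matX a b n 1 c * matX a b n 2 d" for c d
  have M1: "M j k = var (j + 1) * var k ^ b - var j ^ b * var (k + 1)" if "j < n" "k < n" for j k
    using that by (simp add: M_def matX_def)
  have M2: "M k j = var j ^ b * var (k + 1) - var (j + 1) * var k ^ b" if "j < n" "k < n" for j k
    using that by (simp add: M_def matX_def mult.commute)
  have M3: "M n l = var 1 ^ (a + 1) * var l ^ b - var (l + 1) * var n ^ b" if "l < n" for l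
    using that by (simp add: M_def matX_def mult.commute)
  have M4: "M l n = var (l + 1) * var n ^ b - var 1 ^ (a + 1) * var l ^ b" if "l < n" for l
    using that by (simp add: M_def matX_def mult.commute)
  have R: "?R = {M c d | c d. c \<in> {1..n} \<and> d \<in> {1..n} \<and>
      (i \<le> c \<and> c < d \<or> c < d \<and> d < i \<or> d < i \<and> i \<le> c)}"
    by (simp only: M_def)
  have i: "1 \<le> i" "i \<le> n" using i_range by auto
  show "?L \<subseteq> ?R"
  proof
    fix f :: "'k mpoly" assume "f \<in> ?L"
    then consider j k where "f = M j k" "i \<le> j" "j < k" "k < n"
      | j k where "f = M j k" "1 \<le> j" "j < k" "k < i"
      | k j where "f = M k j" "1 \<le> j" "j < i" "i \<le> k" "k < n"
      | l where "f = M n l" "1 \<le> l" "l < i" | l where "f = M l n" "i \<le> l" "l < n"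
      unfolding Un_iff
    proof (elim disjE)
      assume "f \<in> G1 b n i"
      then obtain j k where jk: "f = var (j + 1) * var k ^ b - var j ^ b * var (k + 1)"
        "j \<in> {i..n - 2}" "k \<in> {j + 1..n - 1}" by (auto simp: G1_def)
      show ?thesis by (rule that(1)[of j k]) (use jk n_gt_1 i in \<open>auto simp: M1\<close>)
    next
      assume "f \<in> G2 b i"
      then obtain j k where jk: "f = var (j + 1) * var k ^ b - var j ^ b * var (k + 1)"
        "j \<in> {1..i - 2}" "k \<in> {j + 1..i - 1}" by (auto simp: G2_def)
      show ?thesis by (rule that(2)[of j k]) (use jk n_gt_1 i in \<open>auto simp: M1\<close>)
    next
      assume "f \<in> G3 b n i"
      then obtain j k where jk: "f = var j ^ b * var (k + 1) - var (j + 1) * var k ^ b"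
        "j \<in> {1..i - 1}" "k \<in> {i..n - 1}" by (auto simp: G3_def)
      show ?thesis by (rule that(3)[of k j]) (use jk n_gt_1 i in \<open>auto simp: M2\<close>)
    next
      assume "f \<in> G4 a b n i"
      then consider l where "f = var 1 ^ (a + 1) * var l ^ b - var (l + 1) * var n ^ b" "l \<in> {1..i - 1}"
        | l where "f = var (l + 1) * var n ^ b - var 1 ^ (a + 1) * var l ^ b" "l \<in> {i..n - 1}"
        unfolding G4_def by blast
      then show ?thesis
      proof cases
        case (1 l)
        show ?thesis by (rule that(4)[of l]) (use 1 n_gt_1 i in \<open>auto simp: M3\<close>)
      next
        case (2 l)
        show ?thesis by (rule that(5)[of l]) (use 2 n_gt_1 i in \<open>auto simp: M4\<close>)
      qed
    qed
    then show "f \<in> ?R"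
    proof cases
      case (1 j k)
      then show ?thesis unfolding R mem_Collect_eq
        using i by (intro exI[of _ j] exI[of _ k]) auto
    next
      case (2 j k)
      then show ?thesis unfolding R mem_Collect_eq
        using i by (intro exI[of _ j] exI[of _ k]) auto
    next
      case (3 k j)
      then show ?thesis unfolding R mem_Collect_eq
        using i by (intro exI[of _ k] exI[of _ j]) auto
    next
      case (4 l)
      then show ?thesis unfolding R mem_Collect_eq
        using i by (intro exI[of _ n] exI[of _ l]) auto
    next
      case (5 l)
      then show ?thesis unfolding R mem_Collect_eq
        using i by (intro exI[of _ l] exI[of _ n]) auto
    qed
  qed
  show "?R \<subseteq> ?L"
  proof
    fix f :: "'k mpoly" assume "f \<in> ?R"
    then obtain c d where f: "f = M c d" and cd: "c \<in> {1..n}" "d \<in> {1..n}"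
      and before: "i \<le> c \<and> c < d \<or> c < d \<and> d < i \<or> d < i \<and> i \<le> c"
      unfolding R by blast
    have "c \<le> n" "d \<le> n" using cd by auto
    then have "i \<le> c \<and> c < d \<and> d < n \<or> i \<le> c \<and> c < n \<and> d = n \<or> c < d \<and> d < i
      \<or> d < i \<and> i \<le> c \<and> c < n \<or> d < i \<and> c = n"
      using before by presburger
    then consider "i \<le> c" "c < d" "d < n" | "i \<le> c" "c < n" "d = n" | "c < d" "d < i"
      | "d < i" "i \<le> c" "c < n" | "d < i" "c = n"
      by blast
    then show "f \<in> ?L"
    proof cases
      case 1
      then have "f \<in> G1 b n i"
        unfolding G1_def mem_Collect_eq
        by (intro exI[of _ c] exI[of _ d] conjI) (auto simp: f M1)
      then show ?thesis by blast
    next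
      case 2
      then have "f \<in> G4 a b n i"
        unfolding G4_def Un_iff mem_Collect_eq
        by (intro disjI2 exI[of _ c] conjI) (auto simp: f M4)
      then show ?thesis by blast
    next
      case 3
      then have "f \<in> G2 b i"
        unfolding G2_def mem_Collect_eq using cd i
        by (intro exI[of _ c] exI[of _ d] conjI) (auto simp: f M1)
      then show ?thesis by blast
    next
      case 4
      then have "f \<in> G3 b n i"
        unfolding G3_def mem_Collect_eq using cd i
        by (intro exI[of _ d] exI[of _ c] conjI) (auto simp: f M2)
      then show ?thesis by blast
    next
      case 5
      then have "f \<in> G4 a b n i"
        unfolding G4_def Un_iff mem_Collect_eq using cd i
        by (intro disjI1 exI[of _ d] conjI) (auto simp: f M3)
      then show ?thesis by blast
    qed
  qed
qed

lemma cyc_order: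
  "{(c, d). c \<in> {1..n} \<and> d \<in> {1..n} \<and> (i \<le> c \<and> c < d \<or> c < d \<and> d < i \<or> d < i \<and> i \<le> c)} =
    (\<lambda>(p, q). (cyc p, cyc q)) ` {(p, q). p < q \<and> q < n}" (is "?L = ?R")
proof
  have before: "(i \<le> cyc p \<and> cyc p < cyc q \<or> cyc p < cyc q \<and> cyc q < i \<or> cyc q < i \<and> i \<le> cyc p)
      \<longleftrightarrow> p < q" if "p < n" "q < n" for p q
    using that i_range unfolding cyc_def by (cases "p \<le> n - i"; cases "q \<le> n - i"; simp; linarith)
  show "?L \<subseteq> ?R"
  proof clarify
    fix c d assume "c \<in> {1..n}" "d \<in> {1..n}"
      and *: "i \<le> c \<and> c < d \<or> c < d \<and> d < i \<or> d < i \<and> i \<le> c"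
    then obtain p q where pq: "p < n" "q < n" "c = cyc p" "d = cyc q" using cyc_surj by metis
    then have "p < q" using * before[of p q] by simp
    then show "(c, d) \<in> ?R" using pq by auto
  qed
  show "?R \<subseteq> ?L"
  proof clarify
    fix p q assume "p < q" "q < n"
    then show "cyc p \<in> {1..n} \<and> cyc q \<in> {1..n} \<and> (i \<le> cyc p \<and> cyc p < cyc q \<or>
        cyc p < cyc q \<and> cyc q < i \<or> cyc q < i \<and> i \<le> cyc p)"
      using cyc_range[of p] cyc_range[of q] before[of p q] by simp
  qed
qed

lemma G_eq_signed_minors:
  "G1 b n i \<union> G2 b i \<union> G3 b n i \<union> G4 a b n i = (signed_minors :: ('k::field) mpoly set)"
proof -
  define M :: "nat \<times> nat \<Rightarrow> 'k mpoly"
    where "M = (\<lambda>(c, d). matX a b n 2 c * matX a b n 1 d - matX a b n 1 c * matX a b n 2 d)"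
  have "G1 b n i \<union> G2 b i \<union> G3 b n i \<union> G4 a b n i =
    M ` {(c, d). c \<in> {1..n} \<and> d \<in> {1..n} \<and> (i \<le> c \<and> c < d \<or> c < d \<and> d < i \<or> d < i \<and> i \<le> c)}"
    unfolding G_eq_minors_by_column M_def by auto
  also have "\<dots> = signed_minors"
    unfolding cyc_order signed_minors_def image_image
    by (rule image_cong) (auto simp: M_def minor_matX)
  finally show ?thesis .
qed

section \<open>The Groebner basis property\<close>

lemma minors2_carrier: "minors2 n (matX a b n) \<subseteq> carrier (mpoly_ring n :: ('k::field) mpoly ring)"
proof
  fix f :: "'k mpoly" assume "f \<in> minors2 n (matX a b n)"
  then obtain c d where cd: "c \<in> {1..n}" "d \<in> {1..n}"
    and f: "f = Poly_Mapping.single (top_monom b c + bottom_monom a n d) 1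
      - Poly_Mapping.single (top_monom b d + bottom_monom a n c) 1"
    unfolding minors2_def mem_Collect_eq matX_top matX_bottom mult_single by auto
  have "top_monom b c \<in> monoms n" "bottom_monom a n c \<in> monoms n" if "c \<in> {1..n}" for c
    using that by (auto simp: top_monom_def bottom_monom_def monoms_def)
  then have "top_monom b c + bottom_monom a n d \<in> monoms n"
    "top_monom b d + bottom_monom a n c \<in> monoms n"
    using cd monoms_add by blast+
  then show "f \<in> carrier (mpoly_ring n)"
    unfolding carrier_mpoly_ring f using keys_diff by fastforce
qed

lemma I2X_ideal: "ideal (I2X a b n) (mpoly_ring n :: ('k::field) mpoly ring)"
proof -
  interpret P: cring "mpoly_ring n :: 'k mpoly ring" by (rule mpoly_ring_cring)
  show ?thesis unfolding I2X_def by (rule P.genideal_ideal[OF minors2_carrier])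
qed

lemma signed_minors_subset: "signed_minors \<subseteq> (I2X a b n :: ('k::field) mpoly set)"
proof -
  interpret P: cring "mpoly_ring n :: 'k mpoly ring" by (rule mpoly_ring_cring)
  interpret I: ideal "I2X a b n :: 'k mpoly set" "mpoly_ring n" by (rule I2X_ideal)
  have gen: "minors2 n (matX a b n) \<subseteq> (I2X a b n :: 'k mpoly set)"
    unfolding I2X_def by (rule P.genideal_self[OF minors2_carrier])
  have "minor p q \<in> (I2X a b n :: 'k mpoly set)" if "p < q" "q < n" for p q
  proof -
    have range: "cyc p \<in> {1..n}" "cyc q \<in> {1..n}" and neq: "cyc p \<noteq> cyc q"
      using cyc_range[of p] cyc_range[of q] inj_onD[OF cyc_inj0, of p q] that by auto
    show ?thesis
    proof (cases "cyc q < cyc p")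
      case True
      have "(minor p q :: 'k mpoly) \<in> minors2 n (matX a b n)"
        unfolding minors2_def mem_Collect_eq
        by (intro exI[of _ "cyc q"] exI[of _ "cyc p"])
          (use True range in \<open>simp only: minor_matX mult.commute simp_thms\<close>)
      then show ?thesis using gen by blast
    next
      case False
      have "- (minor p q :: 'k mpoly) \<in> minors2 n (matX a b n)"
        unfolding minors2_def mem_Collect_eq
        by (intro exI[of _ "cyc p"] exI[of _ "cyc q"])
          (use False neq range in \<open>simp add: minor_matX mult.commute\<close>)
      then have neg: "- (minor p q :: 'k mpoly) \<in> I2X a b n" using gen by blast
      have "\<ominus>\<^bsub>mpoly_ring n\<^esub> (- minor p q) = (minor p q :: 'k mpoly)"
        by (rule P.minus_equality)
          (use minor_carrier[OF that, where ?'k = 'k] in \<open>simp_all add: mpoly_ring_def\<close>)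
      then show ?thesis using I.a_inv_closed[OF neg] by simp
    qed
  qed
  then show ?thesis by (auto simp: signed_minors_def)
qed

text \<open>
  The polynomials whose coefficient sums vanish form an ideal, and it contains the minors because
  their two monomials are congruent and have opposite coefficients.
\<close>

lemma I2X_class_sum:
  assumes "f \<in> (I2X a b n :: ('k::field) mpoly set)"
  shows "f \<in> carrier (mpoly_ring n)" and "class_sum {v. lattice_cong a b n v u} f = 0"
proof -
  interpret P: cring "mpoly_ring n :: 'k mpoly ring" by (rule mpoly_ring_cring)
  let ?K = "{f \<in> carrier (mpoly_ring n :: 'k mpoly ring).
    \<forall>u. class_sum {v. lattice_cong a b n v u} f = 0}"
  have "minors2 n (matX a b n) \<subseteq> ?K"
  proof
    fix g :: "'k mpoly" assume g: "g \<in> minors2 n (matX a b n)"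
    then obtain c d where cd: "c \<in> {1..n}" "d \<in> {1..n}"
      and g_eq: "g = Poly_Mapping.single (top_monom b c + bottom_monom a n d) 1
        - Poly_Mapping.single (top_monom b d + bottom_monom a n c) 1"
      unfolding minors2_def mem_Collect_eq matX_top matX_bottom mult_single by auto
    have "lattice_cong a b n (top_monom b d + bottom_monom a n c) (top_monom b c + bottom_monom a n d)"
      using displaced_minor[OF cd, of a b] by (auto simp: lattice_cong_def add.commute)
    then have "lattice_cong a b n (top_monom b d + bottom_monom a n c) u \<longleftrightarrow>
      lattice_cong a b n (top_monom b c + bottom_monom a n d) u" for u
      using lattice_cong_sym lattice_cong_trans by blast
    then show "g \<in> ?K"
      using g minors2_carrier by (auto simp: g_eq class_sum_diff class_sum_single)
  qed
  then have "I2X a b n \<subseteq> ?K"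
    unfolding I2X_def
    by (intro P.genideal_minimal class_sums_zero_ideal lattice_cong_refl lattice_cong_add)
      (use lattice_cong_sym lattice_cong_trans in blast)+
  then show "f \<in> carrier (mpoly_ring n)" and "class_sum {v. lattice_cong a b n v u} f = 0"
    using assms by blast+
qed

text \<open>
  All other monomials of \<open>f\<close> are smaller than its leading monomial, whereas all other monomials of the
  class of a standard monomial are larger. A standard leading monomial would therefore be alone in
  its class, with a coefficient sum equal to the leading coefficient.
\<close>

lemma lead_monom_not_standard:
  assumes f: "f \<in> (I2X a b n :: ('k::field) mpoly set)" and "f \<noteq> 0"
  shows "\<not> standard (lead_monom (prec a b n i) f)"
proof
  define u where "u = lead_monom (prec a b n i) f"
  assume "standard (lead_monom (prec a b n i) f)"
  then have std: "standard u" by (simp add: u_def)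
  have keys: "Poly_Mapping.keys f \<subseteq> monoms n"
    using I2X_class_sum(1)[OF f] by (simp add: carrier_mpoly_ring)
  have u: "u \<in> Poly_Mapping.keys f"
    and max: "\<And>v. v \<in> Poly_Mapping.keys f \<Longrightarrow> v \<noteq> u \<Longrightarrow> prec a b n i v u"
    unfolding u_def using lead_monom_greatest[OF prec_order keys \<open>f \<noteq> 0\<close>] by blast+
  have "v = u" if "v \<in> Poly_Mapping.keys f" "lattice_cong a b n v u" for v
  proof (rule ccontr)
    assume "v \<noteq> u"
    then have "prec a b n i u v"
      using standard_prec[OF std, of v] lattice_cong_sym[OF that(2)] u that(1) keys by blast
    then show False using max[OF that(1) \<open>v \<noteq> u\<close>] term_order_asym[OF prec_order, of u v] u that(1) keys
      by blast
  qed
  then have "Poly_Mapping.keys f \<inter> {v. lattice_cong a b n v u} = {u}"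
    using u lattice_cong_refl by blast
  then have "class_sum {v. lattice_cong a b n v u} f = Poly_Mapping.lookup f u"
    by (simp add: class_sum_def)
  then show False using I2X_class_sum(2)[OF f, of u] u by (simp add: in_keys_iff)
qed

lemma single_carrier:
  "u \<in> monoms n \<Longrightarrow> Poly_Mapping.single u c \<in> carrier (mpoly_ring n :: ('k::field) mpoly ring)"
  by (simp add: carrier_mpoly_ring)

lemma signed_minors_groebner:
  "groebner_basis n (prec a b n i) (I2X a b n) (signed_minors :: ('k::field) mpoly set)"
proof -
  interpret P: cring "mpoly_ring n :: 'k mpoly ring" by (rule mpoly_ring_cring)
  let ?lt = "lead_term (prec a b n i) :: 'k mpoly \<Rightarrow> 'k mpoly"
  let ?G = "signed_minors :: 'k mpoly set" and ?I = "I2X a b n :: 'k mpoly set"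
  have carrier: "?lt ` (?I - {0}) \<subseteq> carrier (mpoly_ring n)"
  proof (rule image_subsetI)
    fix f assume f: "f \<in> ?I - {0}"
    then have "f \<in> carrier (mpoly_ring n)"
      by (intro I2X_class_sum(1)) simp
    then have "Poly_Mapping.keys f \<subseteq> monoms n"
      by (simp add: carrier_mpoly_ring)
    then show "?lt f \<in> carrier (mpoly_ring n)"
      using lead_monom_greatest(1)[OF prec_order, of f] f unfolding lead_term_def
      by (intro single_carrier) blast
  qed
  have sub: "?lt ` (?G - {0}) \<subseteq> ?lt ` (?I - {0})"
    using signed_minors_subset by blast
  interpret J: ideal "initial_ideal n (prec a b n i) ?G" "mpoly_ring n"
    unfolding initial_ideal_def by (rule P.genideal_ideal) (use carrier sub in blast)
  have gens: "?lt ` (?G - {0}) \<subseteq> initial_ideal n (prec a b n i) ?G"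
    unfolding initial_ideal_def by (rule P.genideal_self) (use carrier sub in blast)
  have "?lt ` (?I - {0}) \<subseteq> initial_ideal n (prec a b n i) ?G"
  proof (rule image_subsetI)
    fix f assume "f \<in> ?I - {0}"
    then have f: "f \<in> ?I" "f \<noteq> 0" by auto
    let ?u = "lead_monom (prec a b n i) f"
    obtain p q w where pq: "p < q" "q < n" and u: "?u = lead p q + w"
      using lead_monom_not_standard[OF f] unfolding standard_def by blast
    have "?u \<in> monoms n"
      using lead_monom_greatest(1)[OF prec_order, of f] f I2X_class_sum(1)[of f]
      by (auto simp: carrier_mpoly_ring)
    moreover have "Poly_Mapping.keys w \<subseteq> Poly_Mapping.keys ?u"
      by (auto simp: u in_keys_iff lookup_add)
    ultimately have w: "w \<in> monoms n" by (simp add: monoms_def)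
    have "?lt (minor p q) \<in> initial_ideal n (prec a b n i) ?G"
      using gens minor_nonzero[OF pq] pq unfolding signed_minors_def by blast
    then have "?lt (minor p q) \<otimes>\<^bsub>mpoly_ring n\<^esub>
        Poly_Mapping.single w (lead_coef (prec a b n i) f) \<in> initial_ideal n (prec a b n i) ?G"
      using single_carrier[OF w] by (rule J.I_r_closed)
    also have "?lt (minor p q) \<otimes>\<^bsub>mpoly_ring n\<^esub>
        Poly_Mapping.single w (lead_coef (prec a b n i) f) = ?lt f"
      unfolding lead_term_minor[OF pq] by (simp add: lead_term_def u mpoly_ring_def mult_single)
    finally show "?lt f \<in> initial_ideal n (prec a b n i) ?G" .
  qed
  then have "initial_ideal n (prec a b n i) ?I \<subseteq> initial_ideal n (prec a b n i) ?G"
    unfolding initial_ideal_def[of n _ ?I] by (rule P.genideal_minimal[OF J.is_ideal])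
  moreover have "initial_ideal n (prec a b n i) ?G \<subseteq> initial_ideal n (prec a b n i) ?I"
    unfolding initial_ideal_def by (rule P.subset_Idl_subset[OF carrier sub])
  moreover have "finite ?G"
    unfolding signed_minors_def using finite_pairs by blast
  ultimately show ?thesis
    using signed_minors_subset by (simp add: groebner_basis_def)
qed

lemma signed_minors_minimal:
  "minimal_groebner_basis n (prec a b n i) (I2X a b n) (signed_minors :: ('k::field) mpoly set)"
  unfolding minimal_groebner_basis_def
proof (intro conjI ballI impI signed_minors_groebner)
  fix g :: "'k mpoly" assume "g \<in> signed_minors"
  then show "lead_coef (prec a b n i) g = 1"
    by (auto simp: signed_minors_def lead_coef_minor)
next
  fix g h :: "'k mpoly" assume "g \<in> signed_minors" "h \<in> signed_minors" and neq: "g \<noteq> h"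
  then obtain p q r s where pq: "p < q" "q < n" "g = minor p q" and rs: "r < s" "s < n" "h = minor r s"
    by (auto simp: signed_minors_def)
  show "\<not> lead_term (prec a b n i) g divides\<^bsub>mpoly_ring n\<^esub> lead_term (prec a b n i) h"
  proof
    assume "lead_term (prec a b n i) g divides\<^bsub>mpoly_ring n\<^esub> lead_term (prec a b n i) h"
    then obtain f :: "'k mpoly"
      where "Poly_Mapping.single (lead r s) 1 = Poly_Mapping.single (lead p q) 1 * f"
      using pq rs by (auto simp: factor_def lead_term_minor mpoly_ring_def)
    then have "Poly_Mapping.keys (Poly_Mapping.single (lead r s) (1 :: 'k)) \<subseteq>
        {u + w | u w. u \<in> Poly_Mapping.keys (Poly_Mapping.single (lead p q) (1 :: 'k)) \<and>
          w \<in> Poly_Mapping.keys f}"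
      using keys_mult[of "Poly_Mapping.single (lead p q) (1 :: 'k)" f] by auto
    then obtain w where "lead r s = lead p q + w" by auto
    then show False using lead_divides_lead[of p q r s w] pq rs neq by simp
  qed
qed

end

theorem theorem7:
  fixes a b n i :: nat and \<G> :: "('k::field) mpoly set"
  assumes "a > 0" and "b > 0" and "n > 1" and "i \<in> {1..n}"
    and "\<G> = G1 b n i \<union> G2 b i \<union> G3 b n i \<union> G4 a b n i"
  shows "minimal_groebner_basis n (prec a b n i) (I2X a b n) \<G> \<and> card \<G> = n choose 2"
proof -
  interpret rotated_columns a b n i
    using assms by unfold_locales
  show ?thesis
    unfolding assms(5) G_eq_signed_minors using signed_minors_minimal card_signed_minors by blast
qed

end
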